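(* Each isomorphism class of oriented planar lattices contains a unique member in planar canonical form.
   Context: "Order" means strict partial order (irreflexive and transitive); $\prec$ is the covering relation of the lattice order. A complementary order relation of a finite ordered set $(P,<)$ is a strict partial order $\lambda$ on $P$ such that any two distinct elements of $P$ are comparable by exactly one of $<$ and $\lambda$. Points of $\mathbb{R}^2$ are written $u=(u_x,u_y)$, and $\overline{pq}$ is the straight line segment from $p$ to $q$. A diagram is a finite ordered set $H$ whose elements are distinct points of $\mathbb{R}^2$ such that for each covering $p\prec q$ in $H$ we have $p_y<q_y$ and $\overline{pq}\cap H=\{p,q\}$. A diagram is planar if any two distinct covering segments are disjoint or intersect only at their endpoints. A planar lattice diagram is a planar diagram that is a lattice as an ordered set; a finite lattice is planar if it is isomorphic to some planar lattice diagram. For a finite strictly ordered set $(P,\rho)$ and $p\in P$, the imbalance is $\mathrm{Imb}(p,\rho)=|\{q\in P: q\mathrel{\rho}p\}|-|\{q\in P: p\mathrel{\rho}q\}|$. The slanted order on $\mathbb{R}^2$: $p<q$ if $p\ne q$ and the vector $q-p$ makes an angle of at most $45^\circ$ (in absolute value) with the positive $y$-axis. Its complementary order $<_{\mathrm{lr}}$: $p<_{\mathrm{lr}}q$ if $p\neq q$ and $q-p$ makes an angle of less than $45^\circ$ (in absolute value) with the positive $x$-axis. Subsets of $\mathbb{R}^2$ with slanted order carry the restrictions of $<$ and $<_{\mathrm{lr}}$. An oriented planar lattice is a triple $(L,<,\lambda)$ where $(L,<)$ is a planar lattice and $\lambda$ is a specified order relation complementary to $<$. An isomorphism of oriented planar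 lattices is a bijection preserving and reflecting both relations. An oriented planar lattice is in planar canonical form if it is of the form $(M,<,<_{\mathrm{lr}})$ where $M\subseteq\mathbb{R}^2$ is a planar lattice diagram whose order $<$ is the slanted order and $p=(\mathrm{Imb}(p,<_{\mathrm{lr}}),\mathrm{Imb}(p,<))$ for each $p\in M$ (imbalances computed in $M$). *)

theory Defs
  imports "HOL-Analysis.Analysis" "HOL-Algebra.Lattice"
begin

text \<open>Orders are strict. An ordered set is a carrier together with a relation on that carrier,
  so the relation contains no pairs outside the carrier.\<close>

definition strict_order_on :: "'a set \<Rightarrow> 'a rel \<Rightarrow> bool" where
  "strict_order_on P r \<longleftrightarrow> r \<subseteq> P \<times> P \<and> irrefl r \<and> trans r"

definition covers :: "'a rel \<Rightarrow> 'a \<Rightarrow> 'a \<Rightarrow> bool" where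
  "covers r p q \<longleftrightarrow> (p, q) \<in> r \<and> \<not> (\<exists>z. (p, z) \<in> r \<and> (z, q) \<in> r)"

definition gorder_of :: "'a set \<Rightarrow> 'a rel \<Rightarrow> 'a gorder" where
  "gorder_of P r = \<lparr>carrier = P, eq = (=), le = (\<lambda>x y. (x, y) \<in> r\<^sup>=)\<rparr>"

text \<open>The locale predicate \<^const>\<open>lattice\<close> admits the empty carrier, which is excluded here.\<close>

definition finite_lattice :: "'a set \<Rightarrow> 'a rel \<Rightarrow> bool" where
  "finite_lattice L r \<longleftrightarrow>
     finite L \<and> L \<noteq> {} \<and> strict_order_on L r \<and> lattice (gorder_of L r)"

definition complementary_order :: "'a set \<Rightarrow> 'a rel \<Rightarrow> 'a rel \<Rightarrow> bool" where
  "complementary_order P r l \<longleftrightarrow> strict_order_on P l \<and>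
     (\<forall>x\<in>P. \<forall>y\<in>P. x \<noteq> y \<longrightarrow>
        ((x, y) \<in> r \<or> (y, x) \<in> r) \<noteq> ((x, y) \<in> l \<or> (y, x) \<in> l))"

definition rel_iso :: "('a \<Rightarrow> 'b) \<Rightarrow> 'a set \<Rightarrow> 'a rel \<Rightarrow> 'b rel \<Rightarrow> bool" where
  "rel_iso f P r s \<longleftrightarrow> (\<forall>x\<in>P. \<forall>y\<in>P. (x, y) \<in> r \<longleftrightarrow> (f x, f y) \<in> s)"

definition imbalance :: "'a set \<Rightarrow> 'a rel \<Rightarrow> 'a \<Rightarrow> int" where
  "imbalance P r p = int (card {q \<in> P. (q, p) \<in> r}) - int (card {q \<in> P. (p, q) \<in> r})"

type_synonym point = "real \<times> real"

definition diagram :: "point set \<Rightarrow> point rel \<Rightarrow> bool" where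
  "diagram H r \<longleftrightarrow> finite H \<and> strict_order_on H r \<and>
     (\<forall>p q. covers r p q \<longrightarrow> snd p < snd q \<and> closed_segment p q \<inter> H = {p, q})"

text \<open>In a diagram, distinct covering pairs have distinct segments, because the lower endpoint
  is the smaller element of the pair. A common point has to be an endpoint of both segments.\<close>

definition planar_diagram :: "point set \<Rightarrow> point rel \<Rightarrow> bool" where
  "planar_diagram H r \<longleftrightarrow> diagram H r \<and>
     (\<forall>p q p' q'. covers r p q \<and> covers r p' q' \<and> (p, q) \<noteq> (p', q') \<longrightarrow>
        closed_segment p q \<inter> closed_segment p' q' \<subseteq> {p, q} \<inter> {p', q'})"

definition planar_lattice_diagram :: "point set \<Rightarrow> point rel \<Rightarrow> bool" where
  "planar_lattice_diagram H r \<longleftrightarrow> planar_diagram H r \<and> finite_lattice H r"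

definition planar_lattice :: "'a set \<Rightarrow> 'a rel \<Rightarrow> bool" where
  "planar_lattice L r \<longleftrightarrow> finite_lattice L r \<and>
     (\<exists>H s f. planar_lattice_diagram H s \<and> bij_betw f L H \<and> rel_iso f L r s)"

text \<open>The unsigned angle between two nonzero vectors, with values in \<open>[0, \<pi>]\<close>.\<close>

definition vector_angle :: "'a::real_inner \<Rightarrow> 'a \<Rightarrow> real" where
  "vector_angle u v = arccos (inner u v / (norm u * norm v))"

definition slanted_less :: "point rel" where
  "slanted_less = {(p, q). p \<noteq> q \<and> vector_angle (q - p) (0, 1) \<le> pi / 4}"

definition slanted_lr :: "point rel" where
  "slanted_lr = {(p, q). p \<noteq> q \<and> vector_angle (q - p) (1, 0) < pi / 4}"

text \<open>A triple consists of a carrier, its order, and an order complementary to it.\<close>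

type_synonym 'a triple = "'a set \<times> 'a rel \<times> 'a rel"

fun oriented_planar_lattice :: "'a triple \<Rightarrow> bool" where
  "oriented_planar_lattice (L, r, l) \<longleftrightarrow> planar_lattice L r \<and> complementary_order L r l"

fun oriented_iso :: "'a triple \<Rightarrow> 'b triple \<Rightarrow> bool" where
  "oriented_iso (L, r, l) (M, s, m) \<longleftrightarrow>
     (\<exists>f. bij_betw f L M \<and> rel_iso f L r s \<and> rel_iso f L l m)"

fun planar_canonical_form :: "point triple \<Rightarrow> bool" where
  "planar_canonical_form (M, r, l) \<longleftrightarrow> oriented_planar_lattice (M, r, l) \<and>
     planar_lattice_diagram M r \<and> r = Restr slanted_less M \<and> l = Restr slanted_lr M \<and>
     (\<forall>p\<in>M. p = (of_int (imbalance M l p), of_int (imbalance M r p)))"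

end

(* The unions of < and lambda, and of < and the converse of lambda, are both strict (linear)
   orders, and imbalances are additive and strictly monotone. So x + y and y - x, for
   (x, y) = (Imb(p, lambda), Imb(p, <)), order the elements by these two unions, which makes
   p |-> (x, y) an isomorphism onto a set M with the slanted orders. Imbalances are invariant under
   isomorphism, so no other triple in canonical form is possible. M is a planar diagram for any
   lattice: if the segments of two coverings p < q and p' < q' meet in w, then p and p' lie below w
   and q and q' above it, so the join of p and p' is an endpoint of both segments; and segments with
   a common endpoint meet only there, since no element of M lies inside a covering segment. *)

theory Submission
  imports Defs
begin

section \<open>Slanted orders\<close>

lemma quarter_le_arccos_iff:
  fixes c :: real
  assumes "\<bar>c\<bar> \<le> 1"
  shows "arccos c \<le> pi / 4 \<longleftrightarrow> sqrt 2 / 2 \<le> c"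
    and "arccos c < pi / 4 \<longleftrightarrow> sqrt 2 / 2 < c"
proof -
  have a: "arccos (sqrt 2 / 2) = pi / 4"
    using arccos_cos[of "pi / 4"] by (simp add: cos_45)
  have b: "\<bar>sqrt 2 / 2\<bar> \<le> (1::real)"
    using sqrt2_less_2 by simp
  show "arccos c \<le> pi / 4 \<longleftrightarrow> sqrt 2 / 2 \<le> c"
    using arccos_le_mono[OF assms b] by (simp add: a)
  show "arccos c < pi / 4 \<longleftrightarrow> sqrt 2 / 2 < c"
    using arccos_less_mono[OF assms b] by (simp add: a)
qed

text \<open>The quotient is the cosine of the angle between \<open>(x, y)\<close> and the positive
  y-axis. For \<open>0 \<le> y\<close>, clearing the denominator and squaring reduces each claim to
  comparing the squares of \<open>x\<close> and \<open>y\<close>; for negative \<open>y\<close> both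
  sides are false.\<close>

lemma sqrt_half_le_ratio_iff:
  fixes x y :: real
  assumes "(x, y) \<noteq> (0, 0)"
  shows "sqrt 2 / 2 \<le> y / sqrt (x\<^sup>2 + y\<^sup>2) \<longleftrightarrow> \<bar>x\<bar> \<le> y"
    and "sqrt 2 / 2 < y / sqrt (x\<^sup>2 + y\<^sup>2) \<longleftrightarrow> \<bar>x\<bar> < y"
proof -
  have pos: "sqrt (x\<^sup>2 + y\<^sup>2) > 0"
    using assms by (auto simp: sum_power2_gt_zero_iff)
  have e: "sqrt 2 / 2 * sqrt (x\<^sup>2 + y\<^sup>2) = sqrt ((x\<^sup>2 + y\<^sup>2) / 2)"
    by (simp add: real_sqrt_divide real_div_sqrt field_simps)
  have "sqrt ((x\<^sup>2 + y\<^sup>2) / 2) \<le> y \<longleftrightarrow> \<bar>x\<bar> \<le> y"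
  proof (cases "0 \<le> y")
    case True
    then have "sqrt ((x\<^sup>2 + y\<^sup>2) / 2) \<le> y \<longleftrightarrow> (x\<^sup>2 + y\<^sup>2) / 2 \<le> y\<^sup>2"
      by (metis real_sqrt_le_iff real_sqrt_unique)
    also have "\<dots> \<longleftrightarrow> \<bar>x\<bar> \<le> y"
      using True abs_le_square_iff[of x y] by auto
    finally show ?thesis .
  next
    case False
    then show ?thesis
      by (smt (verit) real_sqrt_ge_zero sum_power2_ge_zero divide_nonneg_pos)
  qed
  then show "sqrt 2 / 2 \<le> y / sqrt (x\<^sup>2 + y\<^sup>2) \<longleftrightarrow> \<bar>x\<bar> \<le> y"
    using pos by (simp add: pos_le_divide_eq e[simplified])
  have "sqrt ((x\<^sup>2 + y\<^sup>2) / 2) < y \<longleftrightarrow> \<bar>x\<bar> < y"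
  proof (cases "0 \<le> y")
    case True
    then have "sqrt ((x\<^sup>2 + y\<^sup>2) / 2) < y \<longleftrightarrow> (x\<^sup>2 + y\<^sup>2) / 2 < y\<^sup>2"
      by (metis real_sqrt_less_iff real_sqrt_unique)
    also have "\<dots> \<longleftrightarrow> \<bar>x\<bar> < y"
      using True abs_le_square_iff[of y x] by auto
    finally show ?thesis .
  next
    case False
    then show ?thesis
      by (smt (verit) real_sqrt_ge_zero sum_power2_ge_zero divide_nonneg_pos)
  qed
  then show "sqrt 2 / 2 < y / sqrt (x\<^sup>2 + y\<^sup>2) \<longleftrightarrow> \<bar>x\<bar> < y"
    using pos by (simp add: pos_less_divide_eq e[simplified])
qed

lemma abs_ratio_le_1:
  fixes x y :: real
  shows "\<bar>y / sqrt (x\<^sup>2 + y\<^sup>2)\<bar> \<le> 1"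
  by (simp add: abs_divide divide_le_eq_1) (smt (verit) real_sqrt_abs real_sqrt_le_mono zero_le_power2)

lemma slanted_less_iff:
  "(p, q) \<in> slanted_less \<longleftrightarrow> p \<noteq> q \<and> \<bar>fst q - fst p\<bar> \<le> snd q - snd p"
proof (cases "p = q")
  case False
  then have ne: "(fst q - fst p, snd q - snd p) \<noteq> (0, 0)"
    by (auto simp: prod_eq_iff)
  have "vector_angle (q - p) (0, 1) =
      arccos ((snd q - snd p) / sqrt ((fst q - fst p)\<^sup>2 + (snd q - snd p)\<^sup>2))"
    by (cases p; cases q) (simp add: vector_angle_def inner_prod_def norm_Pair)
  then show ?thesis
    using False quarter_le_arccos_iff(1)[OF abs_ratio_le_1] sqrt_half_le_ratio_iff(1)[OF ne]
    by (simp add: slanted_less_def)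
qed (simp add: slanted_less_def)

lemma slanted_lr_iff:
  "(p, q) \<in> slanted_lr \<longleftrightarrow> \<bar>snd q - snd p\<bar> < fst q - fst p"
proof (cases "p = q")
  case False
  \<comment> \<open>The coordinates are interchanged so that the ratio lemma measures the angle to
    the x-axis.\<close>
  then have ne: "(snd q - snd p, fst q - fst p) \<noteq> (0, 0)"
    by (auto simp: prod_eq_iff)
  have "vector_angle (q - p) (1, 0) =
      arccos ((fst q - fst p) / sqrt ((snd q - snd p)\<^sup>2 + (fst q - fst p)\<^sup>2))"
    by (cases p; cases q) (simp add: vector_angle_def inner_prod_def norm_Pair add.commute)
  then show ?thesis
    using False quarter_le_arccos_iff(2)[OF abs_ratio_le_1] sqrt_half_le_ratio_iff(2)[OF ne]
    by (simp add: slanted_lr_def)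
qed (simp add: slanted_lr_def)

section \<open>The slanted relations as complementary orders, and segments in the slanted
  order\<close>

lemma slanted_le_iff:
  "(p, q) \<in> slanted_less\<^sup>= \<longleftrightarrow> \<bar>fst q - fst p\<bar> \<le> snd q - snd p"
  by (auto simp: slanted_less_iff)

lemma slanted_less_snd_less: "(p, q) \<in> slanted_less \<Longrightarrow> snd p < snd q"
  by (auto simp: slanted_less_iff prod_eq_iff)

lemma slanted_le_trans:
  "(p, q) \<in> slanted_less\<^sup>= \<Longrightarrow> (q, z) \<in> slanted_less\<^sup>= \<Longrightarrow> (p, z) \<in> slanted_less\<^sup>="
  unfolding slanted_le_iff by linarith

lemma slanted_le_antisym:
  "(p, q) \<in> slanted_less\<^sup>= \<Longrightarrow> (q, p) \<in> slanted_less\<^sup>= \<Longrightarrow> p = q"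
  unfolding slanted_le_iff by (intro prod_eqI) linarith+

lemma strict_order_on_slanted_less: "strict_order_on M (Restr slanted_less M)"
proof -
  have "trans slanted_less"
  proof (rule transI)
    fix x y z assume xyz: "(x, y) \<in> slanted_less" "(y, z) \<in> slanted_less"
    then have "(x, z) \<in> slanted_less\<^sup>=" using slanted_le_trans[of x y z] by blast
    \<comment> \<open>Strictly increasing height rules out \<open>x = z\<close>.\<close>
    moreover have "snd x < snd z" using xyz slanted_less_snd_less order.strict_trans by blast
    ultimately show "(x, z) \<in> slanted_less" by auto
  qed
  moreover have "irrefl slanted_less"
    by (auto simp: irrefl_def slanted_less_iff)
  ultimately show ?thesis
    unfolding strict_order_on_def by (auto simp: irrefl_def trans_Restr)
qed

text \<open>A nonzero vector \<open>(x, y)\<close> satisfies exactly one of \<bar>x\<bar> \<le>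
  \<bar>y\<bar> and \<bar>y\<bar> < \<bar>x\<bar>.\<close>

lemma complementary_order_slanted:
  "complementary_order M (Restr slanted_less M) (Restr slanted_lr M)"
proof -
  have "trans slanted_lr"
    unfolding trans_def slanted_lr_iff by (smt (verit))
  moreover have "irrefl slanted_lr"
    by (auto simp: irrefl_def slanted_lr_iff)
  ultimately have "strict_order_on M (Restr slanted_lr M)"
    unfolding strict_order_on_def by (auto simp: irrefl_def trans_Restr)
  then show ?thesis
    unfolding complementary_order_def by (auto simp: slanted_less_iff slanted_lr_iff)
qed

text \<open>Both \<open>w - p\<close> and \<open>q - w\<close> are nonnegative multiples of
  \<open>q - p\<close>, and the cone of the slanted order is closed under such multiples.\<close>

lemma closed_segment_slanted_le:
  assumes "(p, q) \<in> slanted_less\<^sup>=" "w \<in> closed_segment p q"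
  shows "(p, w) \<in> slanted_less\<^sup>=" "(w, q) \<in> slanted_less\<^sup>="
proof -
  obtain t where t: "0 \<le> t" "t \<le> 1" and w: "w = (1 - t) *\<^sub>R p + t *\<^sub>R q"
    using assms(2) by (auto simp: in_segment)
  have le: "\<bar>fst q - fst p\<bar> \<le> snd q - snd p"
    using assms(1) unfolding slanted_le_iff .
  have "fst w - fst p = t * (fst q - fst p)" "snd w - snd p = t * (snd q - snd p)"
    "fst q - fst w = (1 - t) * (fst q - fst p)" "snd q - snd w = (1 - t) * (snd q - snd p)"
    by (simp_all add: w algebra_simps)
  then show "(p, w) \<in> slanted_less\<^sup>=" "(w, q) \<in> slanted_less\<^sup>="
    using t le by (simp_all only: slanted_le_iff abs_mult) (simp_all add: mult_left_mono)
qed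

section \<open>Lattices\<close>

lemma join_exists:
  assumes "lattice (gorder_of P r)" "x \<in> P" "y \<in> P"
  shows "\<exists>j\<in>P. (x, j) \<in> r\<^sup>= \<and> (y, j) \<in> r\<^sup>= \<and>
    (\<forall>z\<in>P. (x, z) \<in> r\<^sup>= \<and> (y, z) \<in> r\<^sup>= \<longrightarrow> (j, z) \<in> r\<^sup>=)"
proof -
  interpret lattice "gorder_of P r" by fact
  obtain j where "least (gorder_of P r) j (Upper (gorder_of P r) {x, y})"
    using sup_of_two_exists[of x y] assms by (auto simp: gorder_of_def)
  then show ?thesis
    using assms by (intro bexI[of _ j]) (auto simp: least_def Upper_def gorder_of_def)
qed

lemma meet_exists:
  assumes "lattice (gorder_of P r)" "x \<in> P" "y \<in> P"
  shows "\<exists>m\<in>P. (m, x) \<in> r\<^sup>= \<and> (m, y) \<in> r\<^sup>= \<and>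
    (\<forall>z\<in>P. (z, x) \<in> r\<^sup>= \<and> (z, y) \<in> r\<^sup>= \<longrightarrow> (z, m) \<in> r\<^sup>=)"
proof -
  interpret lattice "gorder_of P r" by fact
  obtain m where "greatest (gorder_of P r) m (Lower (gorder_of P r) {x, y})"
    using inf_of_two_exists[of x y] assms by (auto simp: gorder_of_def)
  then show ?thesis
    using assms by (intro bexI[of _ m]) (auto simp: greatest_def Lower_def gorder_of_def)
qed

lemma lattice_gorder_ofI:
  assumes so: "strict_order_on P r"
    and join: "\<And>x y. x \<in> P \<Longrightarrow> y \<in> P \<Longrightarrow> \<exists>j\<in>P. (x, j) \<in> r\<^sup>= \<and> (y, j) \<in> r\<^sup>= \<and>
      (\<forall>z\<in>P. (x, z) \<in> r\<^sup>= \<and> (y, z) \<in> r\<^sup>= \<longrightarrow> (j, z) \<in> r\<^sup>=)"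
    and meet: "\<And>x y. x \<in> P \<Longrightarrow> y \<in> P \<Longrightarrow> \<exists>m\<in>P. (m, x) \<in> r\<^sup>= \<and> (m, y) \<in> r\<^sup>= \<and>
      (\<forall>z\<in>P. (z, x) \<in> r\<^sup>= \<and> (z, y) \<in> r\<^sup>= \<longrightarrow> (z, m) \<in> r\<^sup>=)"
  shows "lattice (gorder_of P r)"
proof -
  have "irrefl r" "trans r"
    using so by (auto simp: strict_order_on_def)
  then interpret partial_order "gorder_of P r"
    by unfold_locales (auto simp: gorder_of_def irrefl_def dest: transD)
  show ?thesis
  proof unfold_locales
    fix x y assume "x \<in> carrier (gorder_of P r)" "y \<in> carrier (gorder_of P r)"
    then have xy: "x \<in> P" "y \<in> P" by (auto simp: gorder_of_def)
    obtain j where "j \<in> P" "(x, j) \<in> r\<^sup>=" "(y, j) \<in> r\<^sup>="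
      "\<forall>z\<in>P. (x, z) \<in> r\<^sup>= \<and> (y, z) \<in> r\<^sup>= \<longrightarrow> (j, z) \<in> r\<^sup>="
      using join[OF xy] by blast
    then show "\<exists>s. least (gorder_of P r) s (Upper (gorder_of P r) {x, y})"
      using xy by (intro exI[of _ j]) (auto simp: least_def Upper_def gorder_of_def)
    obtain m where "m \<in> P" "(m, x) \<in> r\<^sup>=" "(m, y) \<in> r\<^sup>="
      "\<forall>z\<in>P. (z, x) \<in> r\<^sup>= \<and> (z, y) \<in> r\<^sup>= \<longrightarrow> (z, m) \<in> r\<^sup>="
      using meet[OF xy] by blast
    then show "\<exists>s. greatest (gorder_of P r) s (Lower (gorder_of P r) {x, y})"
      using xy by (intro exI[of _ m]) (auto simp: greatest_def Lower_def gorder_of_def)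
  qed
qed

lemma rel_iso_reflcl:
  assumes "bij_betw f L M" "rel_iso f L r s" "x \<in> L" "y \<in> L"
  shows "(f x, f y) \<in> s\<^sup>= \<longleftrightarrow> (x, y) \<in> r\<^sup>="
  using assms by (auto simp: rel_iso_def bij_betw_def inj_on_def)

lemma lattice_transfer:
  assumes lat: "lattice (gorder_of L r)" and so: "strict_order_on M s"
    and bij: "bij_betw f L M" and iso: "rel_iso f L r s"
  shows "lattice (gorder_of M s)"
proof (rule lattice_gorder_ofI[OF so])
  note eq = rel_iso_reflcl[OF bij iso]
  have M: "M = f ` L" using bij by (simp add: bij_betw_def)
  fix x y assume "x \<in> M" "y \<in> M"
  then obtain a b where ab: "a \<in> L" "b \<in> L" and xy: "x = f a" "y = f b"
    by (auto simp: M)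
  show "\<exists>j\<in>M. (x, j) \<in> s\<^sup>= \<and> (y, j) \<in> s\<^sup>= \<and>
      (\<forall>z\<in>M. (x, z) \<in> s\<^sup>= \<and> (y, z) \<in> s\<^sup>= \<longrightarrow> (j, z) \<in> s\<^sup>=)"
    \<comment> \<open>With \<open>M\<close> as the image of \<open>L\<close>, quantifiers over
      \<open>M\<close> become quantifiers over \<open>L\<close>; the congruence rules supply the
      memberships that \<open>eq\<close> requires.\<close>
    unfolding M xy using join_exists[OF lat ab] ab
    by (simp only: bex_simps ball_simps eq cong: bex_cong ball_cong conj_cong)
  show "\<exists>m\<in>M. (m, x) \<in> s\<^sup>= \<and> (m, y) \<in> s\<^sup>= \<and>
      (\<forall>z\<in>M. (z, x) \<in> s\<^sup>= \<and> (z, y) \<in> s\<^sup>= \<longrightarrow> (z, m) \<in> s\<^sup>=)"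
    unfolding M xy using meet_exists[OF lat ab] ab
    by (simp only: bex_simps ball_simps eq cong: bex_cong ball_cong conj_cong)
qed

lemma finite_lattice_transfer:
  assumes "finite_lattice L r" "strict_order_on M s" "bij_betw f L M" "rel_iso f L r s"
  shows "finite_lattice M s"
  using assms lattice_transfer[of L r M s f] unfolding finite_lattice_def
  by (auto simp: bij_betw_def)

section \<open>Planarity of lattices with slanted order\<close>

text \<open>A second common point makes \<open>q - p\<close> and \<open>q' - p\<close> positive
  multiples of each other, so the shorter segment lies in the longer one.\<close>

lemma closed_segments_common_start:
  fixes p q q' w :: "'a::real_vector"
  assumes "w \<in> closed_segment p q" "w \<in> closed_segment p q'" "w \<noteq> p"
  shows "q \<in> closed_segment p q' \<or> q' \<in> closed_segment p q"
proof -
  obtain t where t: "0 \<le> t" "t \<le> 1" and wt: "w = (1 - t) *\<^sub>R p + t *\<^sub>R q"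
    using assms(1) by (auto simp: in_segment)
  obtain u where u: "0 \<le> u" "u \<le> 1" and wu: "w = (1 - u) *\<^sub>R p + u *\<^sub>R q'"
    using assms(2) by (auto simp: in_segment)
  have eq: "t *\<^sub>R (q - p) = u *\<^sub>R (q' - p)"
    using wt wu by (simp add: algebra_simps)
  have "t \<noteq> 0" "u \<noteq> 0"
    using assms(3) wt wu by auto
  then have pos: "t > 0" "u > 0" using t u by auto
  show ?thesis
  proof (cases "u \<le> t")
    \<comment> \<open>As \<open>t\<close> and \<open>u\<close> scale the two directions to the same
      vector, \<open>u \<le> t\<close> means that \<open>q\<close> is at most as far from
      \<open>p\<close> as \<open>q'\<close>.\<close>
    case True
    have "q - p = (u / t) *\<^sub>R (q' - p)"
      using arg_cong[OF eq, of "\<lambda>v. (1 / t) *\<^sub>R v"] pos by simp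
    then have "q = (1 - u / t) *\<^sub>R p + (u / t) *\<^sub>R q'"
      by (simp add: algebra_simps)
    then show ?thesis
      using True pos unfolding in_segment by (intro disjI1 exI[of _ "u / t"]) simp
  next
    case False
    have "q' - p = (t / u) *\<^sub>R (q - p)"
      using arg_cong[OF eq, of "\<lambda>v. (1 / u) *\<^sub>R v"] pos by simp
    then have "q' = (1 - t / u) *\<^sub>R p + (t / u) *\<^sub>R q"
      by (simp add: algebra_simps)
    then show ?thesis
      using False pos unfolding in_segment by (intro disjI2 exI[of _ "t / u"]) simp
  qed
qed

lemma covers_between:
  assumes "covers r p q" "(p, z) \<in> r\<^sup>=" "(z, q) \<in> r\<^sup>="
  shows "z = p \<or> z = q"
  using assms by (auto simp: covers_def)

text \<open>The slanted order lives on the whole plane: a crossing point of two segments is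
  comparable with their endpoints even when it is not in \<open>M\<close>, so crossings can be
  tested against joins in \<open>M\<close>.\<close>

lemma planar_lattice_diagram_slanted:
  fixes M :: "point set"
  defines "r \<equiv> Restr slanted_less M"
  assumes fl: "finite_lattice M r"
  shows "planar_lattice_diagram M r"
proof -
  have lat: "lattice (gorder_of M r)" and fin: "finite M" and so: "strict_order_on M r"
    using fl by (auto simp: finite_lattice_def)
  \<comment> \<open>Moving between \<open>r\<close> and the order of the plane permits chains
    through points outside \<open>M\<close>.\<close>
  have le: "(x, y) \<in> r\<^sup>= \<longleftrightarrow> (x, y) \<in> slanted_less\<^sup>=" if "x \<in> M" "y \<in> M" for x y
    using that by (auto simp: r_def)
  have cov: "p \<in> M \<and> q \<in> M \<and> p \<noteq> q \<and> (p, q) \<in> slanted_less" if "covers r p q" for p q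
    using that by (auto simp: covers_def r_def slanted_less_iff)
  have seg: "closed_segment p q \<inter> M = {p, q}" if c: "covers r p q" for p q
  proof
    show "closed_segment p q \<inter> M \<subseteq> {p, q}"
      using closed_segment_slanted_le[of p q] cov[OF c] covers_between[OF c] le by blast
  qed (use cov[OF c] in auto)
  have "w \<in> {p, q} \<inter> {p', q'}"
    if c: "covers r p q" and c': "covers r p' q'" and ne: "(p, q) \<noteq> (p', q')"
      and w: "w \<in> closed_segment p q" and w': "w \<in> closed_segment p' q'" for p q p' q' w
  proof -
    note M = cov[OF c] cov[OF c']
    have pw: "(p, w) \<in> slanted_less\<^sup>=" "(w, q) \<in> slanted_less\<^sup>="
      using closed_segment_slanted_le[OF _ w] M by auto
    have pw': "(p', w) \<in> slanted_less\<^sup>=" "(w, q') \<in> slanted_less\<^sup>="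
      using closed_segment_slanted_le[OF _ w'] M by auto
    have "p \<in> M" "p' \<in> M" using M by auto
    then obtain j where j: "j \<in> M" "(p, j) \<in> r\<^sup>=" "(p', j) \<in> r\<^sup>="
      and least: "\<forall>z\<in>M. (p, z) \<in> r\<^sup>= \<and> (p', z) \<in> r\<^sup>= \<longrightarrow> (j, z) \<in> r\<^sup>="
      using join_exists[OF lat] by blast
    \<comment> \<open>By transitivity through \<open>w\<close>, both \<open>q\<close> and
      \<open>q'\<close> are upper bounds of \<open>p\<close> and \<open>p'\<close> in
      \<open>M\<close>.\<close>
    have "(j, q) \<in> r\<^sup>=" "(j, q') \<in> r\<^sup>="
      using least M le slanted_le_trans pw pw' by metis+
    \<comment> \<open>The join lies between the ends of each covering, so it is an endpoint of
      both.\<close>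
    then have "j = p \<or> j = q" "j = p' \<or> j = q'"
      using covers_between[OF c] covers_between[OF c'] j by blast+
    then consider "p = p'" | "p = q'" | "q = p'" | "q = q'"
      by blast
    then show ?thesis
    proof cases
      case 1
      \<comment> \<open>Otherwise one upper end lies on the other segment, which contains no further
        element of \<open>M\<close>; then \<open>q = q'\<close>, and the two coverings
        coincide.\<close>
      have "w = p"
      proof (rule ccontr)
        assume "w \<noteq> p"
        then have "q \<in> closed_segment p q' \<or> q' \<in> closed_segment p q"
          using closed_segments_common_start w w' 1 by blast
        then have "q \<in> {p, q'} \<or> q' \<in> {p, q}"
          using seg[OF c] seg[OF c'] M 1 by blast
        then show False using M 1 ne by auto
      qed
      then show ?thesis using 1 by simp
    next
      case 2
      \<comment> \<open>The coverings are stacked, so \<open>w\<close> is both above and below the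
        shared endpoint.\<close>
      then have "w = p" using slanted_le_antisym pw pw' by blast
      then show ?thesis using 2 by simp
    next
      case 3
      then have "w = q" using slanted_le_antisym pw pw' by blast
      then show ?thesis using 3 by simp
    next
      case 4
      \<comment> \<open>Mirror image of the first case, with the segments reversed to start at the
        common upper end.\<close>
      have "w = q"
      proof (rule ccontr)
        assume "w \<noteq> q"
        then have "p \<in> closed_segment q p' \<or> p' \<in> closed_segment q p"
          using closed_segments_common_start w w' 4 by (metis closed_segment_commute)
        then have "p \<in> {p', q} \<or> p' \<in> {p, q}"
          using seg[OF c] seg[OF c'] M 4 by (metis IntI closed_segment_commute)
        then show False using M 4 ne by auto
      qed
      then show ?thesis using 4 by simp
    qed
  qed
  then have "closed_segment p q \<inter> closed_segment p' q' \<subseteq> {p, q} \<inter> {p', q'}"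
    if "covers r p q" "covers r p' q'" "(p, q) \<noteq> (p', q')" for p q p' q'
    using that by blast
  moreover have "diagram M r"
    unfolding diagram_def using fin so seg cov slanted_less_snd_less by blast
  ultimately show ?thesis
    unfolding planar_lattice_diagram_def planar_diagram_def using fl by blast
qed

section \<open>Imbalances\<close>

text \<open>Serves both halves of the theorem: the constructed points have the right imbalances in
  their own set, and the points of any canonical form are determined by \<open>L\<close>.\<close>

lemma imbalance_transfer:
  assumes bij: "bij_betw f L M" and iso: "rel_iso f L r s" and p: "p \<in> L"
  shows "imbalance M s (f p) = imbalance L r p"
proof -
  have inj: "inj_on f L" and M: "M = f ` L" using bij by (auto simp: bij_betw_def)
  have "{q \<in> M. (q, f p) \<in> s} = f ` {q \<in> L. (q, p) \<in> r}"
    "{q \<in> M. (f p, q) \<in> s} = f ` {q \<in> L. (p, q) \<in> r}"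
    using iso p by (auto simp: M rel_iso_def)
  moreover have "card (f ` {q \<in> L. Q q}) = card {q \<in> L. Q q}" for Q
    by (rule card_image) (auto intro: inj_on_subset[OF inj])
  ultimately show ?thesis by (simp add: imbalance_def)
qed

lemma imbalance_Un:
  assumes "finite P" "r \<inter> s = {}"
  shows "imbalance P (r \<union> s) p = imbalance P r p + imbalance P s p"
proof -
  have "{q \<in> P. (q, p) \<in> r \<union> s} = {q \<in> P. (q, p) \<in> r} \<union> {q \<in> P. (q, p) \<in> s}"
    "{q \<in> P. (p, q) \<in> r \<union> s} = {q \<in> P. (p, q) \<in> r} \<union> {q \<in> P. (p, q) \<in> s}"
    by auto
  moreover have "card ({q \<in> P. (q, p) \<in> r} \<union> {q \<in> P. (q, p) \<in> s}) =
      card {q \<in> P. (q, p) \<in> r} + card {q \<in> P. (q, p) \<in> s}"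
    "card ({q \<in> P. (p, q) \<in> r} \<union> {q \<in> P. (p, q) \<in> s}) =
      card {q \<in> P. (p, q) \<in> r} + card {q \<in> P. (p, q) \<in> s}"
    using assms by (intro card_Un_disjoint; auto)+
  ultimately show ?thesis by (simp add: imbalance_def)
qed

lemma imbalance_converse: "imbalance P (r\<inverse>) p = - imbalance P r p"
  by (simp add: imbalance_def)

text \<open>Going up, the set of smaller elements grows, gaining at least \<open>p\<close> itself,
  while the set of larger elements can only shrink.\<close>

lemma imbalance_strict_mono:
  assumes "finite P" "strict_order_on P r" "(p, q) \<in> r"
  shows "imbalance P r p < imbalance P r q"
proof -
  have r: "irrefl r" "trans r" "p \<in> P" using assms by (auto simp: strict_order_on_def)
  have "{z \<in> P. (z, p) \<in> r} \<subset> {z \<in> P. (z, q) \<in> r}"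
    using r assms(3) by (auto simp: irrefl_def dest: transD)
  moreover have "{z \<in> P. (q, z) \<in> r} \<subseteq> {z \<in> P. (p, z) \<in> r}"
    using r assms(3) by (auto dest: transD)
  ultimately have "card {z \<in> P. (z, p) \<in> r} < card {z \<in> P. (z, q) \<in> r}"
    "card {z \<in> P. (q, z) \<in> r} \<le> card {z \<in> P. (p, z) \<in> r}"
    using assms(1) by (auto intro: psubset_card_mono card_mono)
  then show ?thesis by (simp add: imbalance_def)
qed

section \<open>Unions of complementary orders\<close>

text \<open>Supplies the disjointness for additivity of imbalances; irreflexivity of
  \<open>l\<close> settles the diagonal, about which the comparability clause says nothing.\<close>

lemma complementary_order_disjoint:
  assumes "complementary_order P r l"
  shows "r \<inter> l = {}"
proof (rule equals0I, clarify)
  fix x y assume "(x, y) \<in> r" "(x, y) \<in> l"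
  moreover have "x \<in> P" "y \<in> P" "x \<noteq> y"
    using assms \<open>(x, y) \<in> l\<close>
    by (auto simp: complementary_order_def strict_order_on_def irrefl_def)
  ultimately show False
    using assms by (auto simp: complementary_order_def)
qed

text \<open>Lets each fact about \<open>r \<union> l\<close> be applied to
  \<open>r \<union> l\<inverse>\<close> as well.\<close>

lemma complementary_order_converse:
  "complementary_order P r l \<Longrightarrow> complementary_order P r (l\<inverse>)"
  by (fastforce simp: complementary_order_def strict_order_on_def irrefl_def)

text \<open>Distinct elements are always comparable in the union, so transitivity can fail only
  through a cycle of length two or three. A 2-cycle contradicts exclusivity or asymmetry; in a
  3-cycle, two edges in the same order compose to the reverse of the third edge.\<close>

lemma strict_order_on_Un:
  assumes r: "strict_order_on P r" and c: "complementary_order P r l"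
  shows "strict_order_on P (r \<union> l)"
proof -
  have l: "strict_order_on P l"
    and cmp: "\<And>x y. x \<in> P \<Longrightarrow> y \<in> P \<Longrightarrow> x \<noteq> y \<Longrightarrow>
      ((x, y) \<in> r \<or> (y, x) \<in> r) \<noteq> ((x, y) \<in> l \<or> (y, x) \<in> l)"
    using c by (auto simp: complementary_order_def)
  have P: "r \<subseteq> P \<times> P" "l \<subseteq> P \<times> P" and tr: "trans r" "trans l" and ir: "irrefl r" "irrefl l"
    using r l by (auto simp: strict_order_on_def)
  have asym: "(x, y) \<in> r \<Longrightarrow> (y, x) \<notin> r" "(x, y) \<in> l \<Longrightarrow> (y, x) \<notin> l" for x y
    using ir tr by (meson irreflD transD)+
  have "(x, z) \<in> r \<union> l" if "(x, y) \<in> r \<union> l" "(y, z) \<in> r \<union> l" for x y z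
  proof -
    have xyz: "x \<in> P" "y \<in> P" "z \<in> P" "x \<noteq> y" "y \<noteq> z"
      using that P ir by (auto simp: irrefl_def)
    have "x \<noteq> z"
      using that cmp[of x y] xyz asym[of x y] by auto
    moreover have "(z, x) \<notin> r \<union> l"
    \<comment> \<open>Two consecutive edges of a 3-cycle would be in the same order.\<close>
      using that cmp[of x y] cmp[of y z] cmp[of z x] xyz asym[of x y] asym[of y z] asym[of z x]
        transD[OF tr(1), of x y z] transD[OF tr(1), of y z x] transD[OF tr(1), of z x y]
        transD[OF tr(2), of x y z] transD[OF tr(2), of y z x] transD[OF tr(2), of z x y]
      by auto
    ultimately show ?thesis using cmp[of x z] xyz by blast
  qed
  then show ?thesis
    using P ir unfolding strict_order_on_def by (auto simp: irrefl_def intro: transI)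
qed

section \<open>The embedding by imbalances, and existence and uniqueness of the canonical
  form\<close>

text \<open>By invariance of imbalances, this is the only map that can be an isomorphism onto a
  canonical form.\<close>

definition imbalance_point :: "'a set \<Rightarrow> 'a rel \<Rightarrow> 'a rel \<Rightarrow> 'a \<Rightarrow> point" where
  "imbalance_point L r l p = (of_int (imbalance L l p), of_int (imbalance L r p))"

lemma imbalance_point_iso:
  assumes fin: "finite L" and so: "strict_order_on L r" and c: "complementary_order L r l"
  defines "f \<equiv> imbalance_point L r l"
  shows "inj_on f L" "rel_iso f L r (Restr slanted_less (f ` L))"
    "rel_iso f L l (Restr slanted_lr (f ` L))"
proof -
  note c' = complementary_order_converse[OF c]
  \<comment> \<open>The sum of the coordinates is the imbalance for \<open>r \<union> l\<close>; in
    \<open>down\<close>, vertical minus horizontal is the imbalance for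
    \<open>r \<union> l\<inverse>\<close>.\<close>
  have up: "imbalance L r p + imbalance L l p < imbalance L r q + imbalance L l q"
    if "(p, q) \<in> r \<union> l" for p q
    using imbalance_strict_mono[OF fin strict_order_on_Un[OF so c] that]
      imbalance_Un[OF fin complementary_order_disjoint[OF c]] by simp
  have down: "imbalance L r p - imbalance L l p < imbalance L r q - imbalance L l q"
    if "(p, q) \<in> r \<union> l\<inverse>" for p q
    using imbalance_strict_mono[OF fin strict_order_on_Un[OF so c'] that]
      imbalance_Un[OF fin complementary_order_disjoint[OF c']] by (simp add: imbalance_converse)
  \<comment> \<open>Along \<open>r\<close> both the sum and the difference increase. Along
    \<open>l\<close>, in the next step, the sum increases and the difference decreases.\<close>
  have r: "\<bar>fst (f q) - fst (f p)\<bar> < snd (f q) - snd (f p)" if "(p, q) \<in> r" for p q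
    using up[of p q] down[of p q] that by (simp add: f_def imbalance_point_def)
  have l: "\<bar>snd (f q) - snd (f p)\<bar> < fst (f q) - fst (f p)" if "(p, q) \<in> l" for p q
    using up[of p q] down[of q p] that by (simp add: f_def imbalance_point_def)
  have cases: "(p, q) \<in> r \<or> (q, p) \<in> r \<or> (p, q) \<in> l \<or> (q, p) \<in> l"
    if "p \<in> L" "q \<in> L" "p \<noteq> q" for p q
    using c that by (auto simp: complementary_order_def)
  have ne: "f p \<noteq> f q" if "p \<in> L" "q \<in> L" "p \<noteq> q" for p q
    using cases[OF that] r[of p q] r[of q p] l[of p q] l[of q p] by auto
  then show "inj_on f L" by (auto intro: inj_onI)
  \<comment> \<open>The converse holds because each of the other cases for a distinct pair forces an
    inequality incompatible with this one.\<close>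
  have "(p, q) \<in> r \<longleftrightarrow> (f p, f q) \<in> slanted_less" if "p \<in> L" "q \<in> L" for p q
    unfolding slanted_less_iff
    using cases[OF that] ne[OF that] r[of p q] r[of q p] l[of p q] l[of q p] by (smt (verit))
  then show "rel_iso f L r (Restr slanted_less (f ` L))"
    by (auto simp: rel_iso_def)
  have "(p, q) \<in> l \<longleftrightarrow> (f p, f q) \<in> slanted_lr" if "p \<in> L" "q \<in> L" for p q
    unfolding slanted_lr_iff
    using cases[OF that] r[of p q] r[of q p] l[of p q] l[of q p] by (smt (verit))
  then show "rel_iso f L l (Restr slanted_lr (f ` L))"
    by (auto simp: rel_iso_def)
qed

theorem corollary14:
  fixes S :: "'a triple"
  assumes "oriented_planar_lattice S"
  shows "\<exists>!T :: point triple. oriented_iso S T \<and> planar_canonical_form T"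
proof -
  obtain L r l where S: "S = (L, r, l)" by (cases S)
  have fl: "finite_lattice L r" and c: "complementary_order L r l"
    using assms by (auto simp: S planar_lattice_def)
  then have fin: "finite L" and so: "strict_order_on L r"
    by (auto simp: finite_lattice_def)
  define f where "f = imbalance_point L r l"
  define M where "M = f ` L"
  define T where "T = (M, Restr slanted_less M, Restr slanted_lr M)"
  have bij: "bij_betw f L M" and iso: "rel_iso f L r (Restr slanted_less M)"
    "rel_iso f L l (Restr slanted_lr M)"
    using imbalance_point_iso[OF fin so c] by (simp_all add: bij_betw_def f_def M_def)
  show ?thesis
  proof (rule ex1I[of _ T])
    have pld: "planar_lattice_diagram M (Restr slanted_less M)"
      by (intro planar_lattice_diagram_slanted
          finite_lattice_transfer[OF fl strict_order_on_slanted_less bij iso(1)])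
    moreover have "planar_lattice M (Restr slanted_less M)"
      \<comment> \<open>\<open>M\<close> is its own planar diagram, with the identity as
        isomorphism.\<close>
      unfolding planar_lattice_def
      using pld by (auto simp: planar_lattice_diagram_def rel_iso_def
          intro!: exI[of _ M] exI[of _ "Restr slanted_less M"] exI[of _ id])
    moreover have "f p = (of_int (imbalance M (Restr slanted_lr M) (f p)),
        of_int (imbalance M (Restr slanted_less M) (f p)))" if "p \<in> L" for p
      unfolding imbalance_transfer[OF bij iso(1) that] imbalance_transfer[OF bij iso(2) that]
      by (simp add: f_def imbalance_point_def)
    ultimately have "planar_canonical_form T"
      unfolding T_def planar_canonical_form.simps oriented_planar_lattice.simps
      using complementary_order_slanted M_def by blast
    then show "oriented_iso S T \<and> planar_canonical_form T"
      using bij iso by (auto simp: S T_def)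
  next
    fix T' :: "point triple"
    assume T': "oriented_iso S T' \<and> planar_canonical_form T'"
    obtain N s m where N: "T' = (N, s, m)" by (cases T')
    obtain g where g: "bij_betw g L N" "rel_iso g L r s" "rel_iso g L l m"
      using conjunct1[OF T'] by (auto simp: S N)
    have can: "s = Restr slanted_less N" "m = Restr slanted_lr N"
      "\<And>p. p \<in> N \<Longrightarrow> p = (of_int (imbalance N m p), of_int (imbalance N s p))"
      using T' unfolding N planar_canonical_form.simps by blast+
    \<comment> \<open>Canonical form makes \<open>g p\<close> the pair of its own imbalances in
      \<open>N\<close>, which equal those of \<open>p\<close> in \<open>L\<close>.\<close>
    have "g p = f p" if "p \<in> L" for p
    proof -
      have "g p = (of_int (imbalance N m (g p)), of_int (imbalance N s (g p)))"
        using g(1) that by (intro can(3)) (rule bij_betwE[THEN bspec])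
      also have "\<dots> = f p"
        unfolding imbalance_transfer[OF g(1,2) that] imbalance_transfer[OF g(1,3) that]
        by (simp add: f_def imbalance_point_def)
      finally show ?thesis .
    qed
    then have "N = M"
      using g(1) by (auto simp: bij_betw_def M_def)
    \<comment> \<open>Both relations of a canonical form are restrictions to its carrier, so equal
      carriers suffice.\<close>
    then show "T' = T" by (simp add: N T_def can)
  qed
qed

end
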